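(* For each positive integer $n$, the unsatisfiability of the CNF formula $$\overline{\mathrm{PHP}_n^{n+1}}:=\bigwedge_{i=1}^{n+1}\left(p_{i1}\lor p_{i2}\lor\cdots\lor p_{in}\right)\ \land\bigwedge_{1\le i<k\le n+1,\ 1\le j\le n}\left(\lnot p_{ij}\lor\lnot p_{kj}\right)$$ in the Boolean variables $p_{ij}$ ($1\le i\le n+1$, $1\le j\le n$) is equivalent to the positivity (i.e. $p_n(x)>0$ for all $x\in\mathbb{Z}_n^{n+1}$) of the function $$p_n:\mathbb{Z}_n^{n+1}\to\mathbb{C},\qquad p_n(x_1,\dots,x_{n+1})=\sum_{1\le i<j\le n+1}\mathrm{Eqv}(x_i,x_j),$$ where $\mathrm{Eqv}(x,y)=1$ if $x=y$ and $\mathrm{Eqv}(x,y)=0$ otherwise. Moreover, $p_n$ admits an FSOS of sparsity at most $O(n^2)$, i.e. there is an absolute constant $C$ such that for every $n$ the function $p_n$ admits an FSOS of sparsity at most $Cn^2$.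
   Context: $\mathbb{Z}_n$ is the cyclic group of order $n$. For a finite abelian group $G$ with character group $\widehat{G}$, every $g:G\to\mathbb{C}$ has a unique Fourier expansion $g=\sum_{\chi\in\widehat{G}}\widehat{g}(\chi)\chi$, and $\operatorname{supp}(g)=\{\chi:\widehat{g}(\chi)\neq0\}$. An FSOS (Fourier sum of squares) of a function $f$ on $G$ is an expression $f=\sum_{i\in I}|g_i|^2$ with a finite family of functions $g_i:G\to\mathbb{C}$; its sparsity is $\big|\bigcup_{i\in I}\operatorname{supp}(g_i)\big|$. *)

theory Defs
  imports
    "HOL-Algebra.Product_Groups"
    "HOL-Algebra.Elementary_Groups"
    "HOL-Library.Complex_Order"
begin

section \<open>Fourier analysis on finite abelian groups\<close>

definition circle_group :: "complex monoid" where
  "circle_group = \<lparr>carrier = {z. cmod z = 1}, monoid.mult = (*), one = 1\<rparr>"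

text \<open>Functions on a group \<open>G\<close> are total HOL functions of which only the values on
  \<open>carrier G\<close> matter. Characters are made extensional, so that two characters that agree on
  \<open>carrier G\<close> are equal.\<close>

definition characters :: "('a, 'm) monoid_scheme \<Rightarrow> ('a \<Rightarrow> complex) set" where
  "characters G = hom G circle_group \<inter> extensional (carrier G)"

definition fourier_expansion ::
    "('a, 'm) monoid_scheme \<Rightarrow> ('a \<Rightarrow> complex) \<Rightarrow> (('a \<Rightarrow> complex) \<Rightarrow> complex) \<Rightarrow> bool" where
  "fourier_expansion G g c \<longleftrightarrow>
     (\<forall>x\<in>carrier G. g x = (\<Sum>\<psi>\<in>characters G. c \<psi> * \<psi> x))"

text \<open>Well defined when \<open>G\<close> is a finite abelian group: the coefficients exist and are unique
  on \<open>characters G\<close>, and extensionality fixes them elsewhere.\<close>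

definition fourier_coeff ::
    "('a, 'm) monoid_scheme \<Rightarrow> ('a \<Rightarrow> complex) \<Rightarrow> ('a \<Rightarrow> complex) \<Rightarrow> complex" where
  "fourier_coeff G g =
     (THE c. c \<in> extensional (characters G) \<and> fourier_expansion G g c)"

definition fourier_supp :: "('a, 'm) monoid_scheme \<Rightarrow> ('a \<Rightarrow> complex) \<Rightarrow> ('a \<Rightarrow> complex) set" where
  "fourier_supp G g = {\<psi> \<in> characters G. fourier_coeff G g \<psi> \<noteq> 0}"

definition is_FSOS ::
    "('a, 'm) monoid_scheme \<Rightarrow> ('a \<Rightarrow> complex) \<Rightarrow> 'i set \<Rightarrow> ('i \<Rightarrow> 'a \<Rightarrow> complex) \<Rightarrow> bool" where
  "is_FSOS G f I g \<longleftrightarrow>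
     finite I \<and> (\<forall>x\<in>carrier G. f x = (\<Sum>i\<in>I. complex_of_real ((cmod (g i x))\<^sup>2)))"

definition FSOS_sparsity ::
    "('a, 'm) monoid_scheme \<Rightarrow> 'i set \<Rightarrow> ('i \<Rightarrow> 'a \<Rightarrow> complex) \<Rightarrow> nat" where
  "FSOS_sparsity G I g = card (\<Union>i\<in>I. fourier_supp G (g i))"


section \<open>CNF formulas and the pigeonhole principle\<close>

datatype 'v literal = Pos 'v | Neg 'v

type_synonym 'v clause = "'v literal set"
type_synonym 'v cnf = "'v clause set"

fun lit_true :: "('v \<Rightarrow> bool) \<Rightarrow> 'v literal \<Rightarrow> bool" where
  "lit_true v (Pos p) \<longleftrightarrow> v p"
| "lit_true v (Neg p) \<longleftrightarrow> \<not> v p"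

definition cnf_true :: "('v \<Rightarrow> bool) \<Rightarrow> 'v cnf \<Rightarrow> bool" where
  "cnf_true v F \<longleftrightarrow> (\<forall>C\<in>F. \<exists>l\<in>C. lit_true v l)"

definition cnf_unsat :: "'v cnf \<Rightarrow> bool" where
  "cnf_unsat F \<longleftrightarrow> \<not> (\<exists>v. cnf_true v F)"

text \<open>The pair \<open>(i, j)\<close> is the Boolean variable \<open>p\<^sub>i\<^sub>j\<close>: pigeon \<open>i\<close> sits in hole \<open>j\<close>.\<close>

definition PHP_cnf :: "nat \<Rightarrow> (nat \<times> nat) cnf" where
  "PHP_cnf n =
     {{Pos (i, j) | j. j \<in> {1..n}} | i. i \<in> {1..n+1}} \<union>
     {{Neg (i, j), Neg (k, j)} | i j k. 1 \<le> i \<and> i < k \<and> k \<le> n + 1 \<and> 1 \<le> j \<and> j \<le> n}"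


section \<open>The pigeonhole function\<close>

definition PHP_group :: "nat \<Rightarrow> (nat \<Rightarrow> int) monoid" where
  "PHP_group n = product_group {1..n+1} (\<lambda>_. integer_mod_group n)"

definition Eqv :: "'a \<Rightarrow> 'a \<Rightarrow> complex" where
  "Eqv x y = (if x = y then 1 else 0)"

definition PHP_fun :: "nat \<Rightarrow> (nat \<Rightarrow> int) \<Rightarrow> complex" where
  "PHP_fun n x = (\<Sum>(i, j)\<in>{(i, j). 1 \<le> i \<and> i < j \<and> j \<le> n + 1}. Eqv (x i) (x j))"

text \<open>The order on \<^typ>\<open>complex\<close> is that of \<^theory>\<open>HOL-Library.Complex_Order\<close>:
  \<open>0 < z\<close> says that \<open>z\<close> is real and positive.\<close>

definition positive_fun :: "('a, 'm) monoid_scheme \<Rightarrow> ('a \<Rightarrow> complex) \<Rightarrow> bool" where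
  "positive_fun G f \<longleftrightarrow> (\<forall>x\<in>carrier G. 0 < f x)"

end

theory Submission
  imports Defs "HOL-Algebra.Multiplicative_Group"
begin

text \<open>
  Both sides of the equivalence say that no map from the \<open>n + 1\<close> pigeons to the \<open>n\<close> holes is
  injective. The value \<open>p\<^sub>n(x)\<close> counts the pairs of coordinates of \<open>x\<close> that collide, so it is
  always a natural number, and it is positive exactly when \<open>x\<close> is not injective
  (\<open>PHP_fun_pos_iff\<close>); a satisfying assignment yields an injective point and conversely
  (\<open>PHP_satisfiable_iff\<close>).

  For the sum of squares let \<open>\<omega> = exp(2 \<pi> i / n)\<close> and let \<open>S\<^sub>k(x) = \<omega>\<^bsup>k x\<^sub>1\<^esup> + \<dots> + \<omega>\<^bsup>k x\<^sub>n\<^sub>+\<^sub>1\<^esup>\<close>. Expanding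
  \<open>\<bar>S\<^sub>k\<bar>\<^sup>2\<close> and summing over all \<open>k < n\<close> leaves \<open>n\<close> times the number of ordered pairs \<open>(i, j)\<close> with
  \<open>x\<^sub>i = x\<^sub>j\<close>, which is \<open>n (n + 1 + 2 p\<^sub>n)\<close>. The term \<open>k = 0\<close> is the constant \<open>(n + 1)\<^sup>2\<close>, and it is more
  than enough to pay for the diagonal term \<open>n (n + 1)\<close>, so that
  \<open>2 n p\<^sub>n = (n + 1) + \<bar>S\<^sub>1\<bar>\<^sup>2 + \<dots> + \<bar>S\<^sub>n\<^sub>-\<^sub>1\<bar>\<^sup>2\<close>
  with a positive constant (\<open>PHP_fun_power_sums\<close>). The right-hand side involves the trivial
  character and \<open>n + 1\<close> characters for each of the \<open>n - 1\<close> remaining frequencies, which makes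
  \<open>1 + (n - 1) (n + 1) = n\<^sup>2\<close>; the constant in the bound is therefore \<open>C = 1\<close>. That an explicit
  sum of characters bounds the Fourier support is \<open>fourier_supp_character_sum\<close>, which rests
  on the orthogonality of characters.
\<close>

section \<open>Characters and Fourier supports\<close>

lemma group_circle_group: "group circle_group"
proof (rule groupI)
  fix z assume "z \<in> carrier circle_group"
  then show "\<exists>y\<in>carrier circle_group. y \<otimes>\<^bsub>circle_group\<^esub> z = \<one>\<^bsub>circle_group\<^esub>"
    by (intro bexI[of _ "inverse z"]) (auto simp: circle_group_def norm_inverse intro!: left_inverse)
qed (auto simp: circle_group_def norm_mult)

lemma characters_mult:
  assumes "\<psi> \<in> characters G" "x \<in> carrier G" "y \<in> carrier G"
  shows "\<psi> (x \<otimes>\<^bsub>G\<^esub> y) = \<psi> x * \<psi> y"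
  using assms by (auto simp: characters_def hom_def circle_group_def)

lemma characters_cnj_mult:
  assumes "\<psi> \<in> characters G" "x \<in> carrier G"
  shows "\<psi> x * cnj (\<psi> x) = 1"
proof -
  have "cmod (\<psi> x) = 1"
    using assms by (auto simp: characters_def hom_def circle_group_def)
  then show ?thesis
    by (simp add: complex_norm_square[symmetric])
qed

lemma (in group) character_pow_order:
  assumes "\<psi> \<in> characters G" "x \<in> carrier G"
  shows "\<psi> x ^ order G = 1"
proof -
  have "\<psi> (x [^] m) = \<psi> x ^ m" for m :: nat
  proof (induction m)
    case 0
    have "\<psi> \<in> hom G circle_group"
      using assms(1) by (simp add: characters_def)
    then have "\<psi> \<one> = \<one>\<^bsub>circle_group\<^esub>"
      by (intro hom_one group_circle_group is_group)
    then show ?case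
      by (simp add: circle_group_def)
  next
    case (Suc m)
    then show ?case
      using assms by (simp add: characters_mult mult.commute)
  qed
  from this[of "order G"] this[of 0] show ?thesis
    using assms(2) by (simp add: pow_order_eq_1)
qed

text \<open>A character of a finite group takes its values among the roots of unity whose order divides
  the group order, so there are only finitely many candidates. The sums over all characters in
  \<^const>\<open>fourier_expansion\<close> are meaningful only because of this: a sum over an infinite set is
  zero by convention.\<close>

lemma (in group) finite_characters:
  assumes "finite (carrier G)"
  shows "finite (characters G)"
proof (rule finite_subset)
  show "characters G \<subseteq> carrier G \<rightarrow>\<^sub>E {z. z ^ order G = 1}"
    by (simp add: subset_iff PiE_iff character_pow_order) (simp add: characters_def)
  have "order G > 0"
    using assms by (simp add: order_gt_0_iff_finite)
  then show "finite (carrier G \<rightarrow>\<^sub>E {z :: complex. z ^ order G = 1})"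
    using assms by (intro finite_PiE finite_roots_unity) auto
qed

text \<open>Translating the summation variable by an element that separates the two characters
  does not change the sum, but multiplies it by a number different from one.\<close>

lemma (in group) characters_orthogonal:
  assumes "\<psi> \<in> characters G" "\<phi> \<in> characters G" "\<psi> \<noteq> \<phi>"
  shows "(\<Sum>x\<in>carrier G. \<psi> x * cnj (\<phi> x)) = 0"
proof -
  obtain y where y: "y \<in> carrier G" "\<psi> y \<noteq> \<phi> y"
    using assms by (metis Int_iff characters_def extensionalityI)
  let ?S = "\<Sum>x\<in>carrier G. \<psi> x * cnj (\<phi> x)"
  have "?S = (\<Sum>x\<in>carrier G. \<psi> (y \<otimes> x) * cnj (\<phi> (y \<otimes> x)))"
    using y(1)
    by (intro sum.reindex_bij_witness[of _ "\<lambda>x. y \<otimes> x" "\<lambda>x. inv y \<otimes> x"])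
      (auto simp: m_assoc[symmetric])
  also have "\<dots> = (\<psi> y * cnj (\<phi> y)) * ?S"
    using y(1) assms by (simp add: characters_mult sum_distrib_left mult_ac)
  finally have "?S = 0 \<or> \<psi> y * cnj (\<phi> y) = 1"
    by simp
  moreover have "\<psi> y * cnj (\<phi> y) \<noteq> 1"
  proof
    assume *: "\<psi> y * cnj (\<phi> y) = 1"
    then have "\<psi> y * cnj (\<phi> y) = \<phi> y * cnj (\<phi> y)"
      using characters_cnj_mult[OF assms(2) y(1)] by simp
    with * y(2) show False
      by (metis mult_cancel_right mult_zero_right zero_neq_one)
  qed
  ultimately show ?thesis
    by simp
qed

text \<open>Pairing an expansion with a character isolates its coefficient by orthogonality. Hence the
  coefficients are determined by the function, which is what the definite description in
  \<^const>\<open>fourier_coeff\<close> requires.\<close>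

lemma (in group) fourier_expansion_coeff:
  assumes fin: "finite (carrier G)" and exp: "fourier_expansion G g c"
    and \<phi>: "\<phi> \<in> characters G"
  shows "c \<phi> = (\<Sum>x\<in>carrier G. g x * cnj (\<phi> x)) / of_nat (order G)"
proof -
  have "(\<Sum>x\<in>carrier G. g x * cnj (\<phi> x)) =
      (\<Sum>x\<in>carrier G. \<Sum>\<psi>\<in>characters G. c \<psi> * (\<psi> x * cnj (\<phi> x)))"
    using exp by (simp add: fourier_expansion_def sum_distrib_right mult.assoc)
  also have "\<dots> = (\<Sum>\<psi>\<in>characters G. c \<psi> * (\<Sum>x\<in>carrier G. \<psi> x * cnj (\<phi> x)))"
    by (subst sum.swap) (simp add: sum_distrib_left)
  also have "\<dots> = (\<Sum>\<psi>\<in>characters G. if \<psi> = \<phi> then c \<phi> * of_nat (order G) else 0)"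
    using \<phi> by (intro sum.cong) (auto simp: characters_orthogonal characters_cnj_mult order_def)
  also have "\<dots> = c \<phi> * of_nat (order G)"
    using \<phi> finite_characters[OF fin] by simp
  finally show ?thesis
    using fin order_gt_0_iff_finite by auto
qed

lemma (in group) fourier_coeff_eqI:
  assumes "finite (carrier G)" "c \<in> extensional (characters G)" "fourier_expansion G g c"
  shows "fourier_coeff G g = c"
  unfolding fourier_coeff_def
proof (rule the_equality)
  fix d assume "d \<in> extensional (characters G) \<and> fourier_expansion G g d"
  then show "d = c"
    using assms by (intro extensionalityI[of d "characters G" c]) (auto simp: fourier_expansion_coeff)
qed (use assms in auto)

text \<open>Supports are bounded by exhibiting an expansion and appealing to uniqueness. The family
  of characters may have repetitions, since the coefficients that belong to the same character
  are added up.\<close>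

lemma (in group) fourier_supp_character_sum:
  assumes fin: "finite (carrier G)" and A: "finite A"
    and \<chi>: "\<And>i. i \<in> A \<Longrightarrow> \<chi> i \<in> characters G"
    and g: "\<And>x. x \<in> carrier G \<Longrightarrow> g x = (\<Sum>i\<in>A. a i * \<chi> i x)"
  shows "fourier_supp G g \<subseteq> \<chi> ` A"
proof -
  define c where "c = (\<lambda>\<psi>\<in>characters G. \<Sum>i\<in>{i\<in>A. \<chi> i = \<psi>}. a i)"
  have "fourier_expansion G g c"
    unfolding fourier_expansion_def
  proof
    fix x assume x: "x \<in> carrier G"
    have "(\<Sum>\<psi>\<in>characters G. c \<psi> * \<psi> x) =
        (\<Sum>\<psi>\<in>characters G. \<Sum>i\<in>{i\<in>A. \<chi> i = \<psi>}. a i * \<chi> i x)"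
      by (simp add: c_def sum_distrib_right)
    also have "\<dots> = (\<Sum>i\<in>A. a i * \<chi> i x)"
      using A \<chi> finite_characters[OF fin] by (intro sum.group) auto
    finally show "g x = (\<Sum>\<psi>\<in>characters G. c \<psi> * \<psi> x)"
      using g[OF x] by simp
  qed
  then have "fourier_coeff G g = c"
    by (intro fourier_coeff_eqI fin) (simp_all add: c_def)
  moreover have "\<psi> \<in> \<chi> ` A" if "\<psi> \<in> characters G" "c \<psi> \<noteq> 0" for \<psi>
  proof (rule ccontr)
    assume "\<psi> \<notin> \<chi> ` A"
    then have "{i\<in>A. \<chi> i = \<psi>} = {}"
      by auto
    with that show False
      by (simp add: c_def)
  qed
  ultimately show ?thesis
    by (auto simp: fourier_supp_def)
qed


section \<open>Roots of unity\<close>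

definition unity_root :: "nat \<Rightarrow> int \<Rightarrow> complex" where
  "unity_root n a = cis (2 * pi * (of_int a / of_nat n))"

lemma unity_root_0 [simp]: "unity_root n 0 = 1"
  by (simp add: unity_root_def)

lemma norm_unity_root [simp]: "cmod (unity_root n a) = 1"
  by (simp add: unity_root_def)

lemma unity_root_add: "unity_root n (a + b) = unity_root n a * unity_root n b"
  by (simp add: unity_root_def cis_mult add_divide_distrib distrib_left)

lemma cnj_unity_root: "cnj (unity_root n a) = unity_root n (- a)"
  by (simp add: unity_root_def cis_cnj)

lemma unity_root_power: "unity_root n a ^ k = unity_root n (int k * a)"
  by (simp add: unity_root_def Complex.DeMoivre mult_ac)

lemma unity_root_eq_1_iff:
  assumes "n \<ge> 1"
  shows "unity_root n a = 1 \<longleftrightarrow> int n dvd a"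
proof
  assume "unity_root n a = 1"
  then have "cos (2 * pi * (of_int a / of_nat n)) = 1"
    by (simp add: unity_root_def complex_eq_iff)
  then obtain k :: int where "2 * pi * (of_int a / of_nat n) = of_int k * 2 * pi"
    by (auto simp: cos_one_2pi_int)
  then have "(of_int a :: real) = of_int (k * int n)"
    using assms by (simp add: field_simps)
  then have "a = k * int n"
    by (simp only: of_int_eq_iff)
  then show "int n dvd a"
    by simp
next
  assume "int n dvd a"
  then obtain k where "a = int n * k" ..
  then show "unity_root n a = 1"
    using assms by (simp add: unity_root_def)
qed

text \<open>The group operation of \<open>\<int>\<^sub>n\<close> reduces modulo \<open>n\<close>; this invariance is what makes the maps
  \<open>a \<mapsto> \<omega>\<^bsup>k a\<^esup>\<close> characters.\<close>

lemma unity_root_mod: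
  assumes "n \<ge> 1"
  shows "unity_root n (k * (a mod int n)) = unity_root n (k * a)"
proof -
  have "k * a = k * (a mod int n) + int n * (k * (a div int n))"
    by (metis distrib_left mod_mult_div_eq mult.left_commute)
  then have "unity_root n (k * a) =
      unity_root n (k * (a mod int n)) * unity_root n (int n * (k * (a div int n)))"
    by (metis unity_root_add)
  moreover have "unity_root n (int n * (k * (a div int n))) = 1"
    using assms by (simp add: unity_root_eq_1_iff)
  ultimately show ?thesis
    by simp
qed

text \<open>This is the Fourier expansion of equality on \<open>\<int>\<^sub>n\<close>: with \<open>a = x - y\<close> and up to the
  factor \<open>n\<close>, the sum is \<open>Eqv(x, y)\<close>.\<close>

lemma sum_unity_root:
  assumes "n \<ge> 1"
  shows "(\<Sum>k<n. unity_root n (int k * a)) = (if int n dvd a then of_nat n else 0)"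
proof (cases "int n dvd a")
  case True
  then have "unity_root n (int k * a) = 1" for k
    by (simp only: unity_root_eq_1_iff[OF assms] dvd_mult)
  with True show ?thesis
    by simp
next
  case False
  have "(\<Sum>k<n. unity_root n (int k * a)) = (\<Sum>k<n. unity_root n a ^ k)"
    by (simp add: unity_root_power)
  also have "\<dots> = (unity_root n a ^ n - 1) / (unity_root n a - 1)"
    using False assms by (intro geometric_sum) (simp add: unity_root_eq_1_iff)
  also have "unity_root n a ^ n = 1"
    using assms by (simp add: unity_root_power unity_root_eq_1_iff)
  finally show ?thesis
    using False by simp
qed


section \<open>The pigeonhole function as a sum of squares\<close>

lemma group_PHP_group: "group (PHP_group n)"
  by (simp add: PHP_group_def)

lemma carrier_PHP_group:
  "n \<ge> 1 \<Longrightarrow> carrier (PHP_group n) = {1..n+1} \<rightarrow>\<^sub>E {0..<int n}"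
  by (simp add: PHP_group_def carrier_integer_mod_group)

lemma finite_carrier_PHP_group: "n \<ge> 1 \<Longrightarrow> finite (carrier (PHP_group n))"
  by (simp only: carrier_PHP_group) (simp add: finite_PiE)

definition coordinate_character :: "nat \<Rightarrow> nat \<Rightarrow> nat \<Rightarrow> (nat \<Rightarrow> int) \<Rightarrow> complex" where
  "coordinate_character n k i = (\<lambda>x\<in>carrier (PHP_group n). unity_root n (int k * x i))"

lemma coordinate_character:
  assumes "n \<ge> 1" "i \<in> {1..n+1}"
  shows "coordinate_character n k i \<in> characters (PHP_group n)"
proof -
  interpret group "PHP_group n"
    by (rule group_PHP_group)
  have "coordinate_character n k i (x \<otimes>\<^bsub>PHP_group n\<^esub> y) =
      coordinate_character n k i x * coordinate_character n k i y"
    if x: "x \<in> carrier (PHP_group n)" and y: "y \<in> carrier (PHP_group n)" for x y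
  proof -
    have "(x \<otimes>\<^bsub>PHP_group n\<^esub> y) i = (x i + y i) mod int n"
      using assms(2) by (simp add: PHP_group_def)
    then show ?thesis
      using m_closed[OF x y] x y assms(1)
      by (simp add: coordinate_character_def unity_root_mod unity_root_add distrib_left)
  qed
  then show ?thesis
    by (auto simp: characters_def hom_def circle_group_def coordinate_character_def)
qed

lemma sum_square_symmetric:
  fixes f :: "nat \<Rightarrow> nat \<Rightarrow> 'a::comm_semiring_1"
  assumes sym: "\<And>i j. f i j = f j i"
  shows "(\<Sum>i\<in>{1..m}. \<Sum>j\<in>{1..m}. f i j) =
    (\<Sum>i\<in>{1..m}. f i i) + 2 * (\<Sum>(i, j)\<in>{(i, j). 1 \<le> i \<and> i < j \<and> j \<le> m}. f i j)"
proof -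
  let ?U = "{(i, j). 1 \<le> i \<and> i < j \<and> j \<le> m}"
  let ?L = "{(i, j). 1 \<le> j \<and> j < i \<and> i \<le> m}"
  let ?D = "(\<lambda>i. (i, i)) ` {1..m}"
  have fin: "finite ?U" "finite ?L"
    by (auto intro: finite_subset[of _ "{1..m} \<times> {1..m}"])
  have "(\<Sum>i\<in>{1..m}. \<Sum>j\<in>{1..m}. f i j) = (\<Sum>(i, j)\<in>{1..m} \<times> {1..m}. f i j)"
    by (simp add: sum.cartesian_product)
  also have "{1..m} \<times> {1..m} = ?D \<union> (?U \<union> ?L)"
    by auto
  also have "(\<Sum>(i, j)\<in>\<dots>. f i j) =
      (\<Sum>(i, j)\<in>?D. f i j) + ((\<Sum>(i, j)\<in>?U. f i j) + (\<Sum>(i, j)\<in>?L. f i j))"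
    using fin by (subst sum.union_disjoint sum.union_disjoint[of ?U], auto)+
  also have "(\<Sum>(i, j)\<in>?L. f i j) = (\<Sum>(i, j)\<in>?U. f i j)"
    by (intro sum.reindex_bij_witness[of _ prod.swap prod.swap]) (auto simp: sym)
  also have "(\<Sum>(i, j)\<in>?D. f i j) = (\<Sum>i\<in>{1..m}. f i i)"
    by (subst sum.reindex) (auto simp: inj_on_def)
  finally show ?thesis
    by (simp add: mult_2)
qed

text \<open>By the expansion of \<open>Eqv\<close>, the power sums over all frequencies \<open>k < n\<close> count the ordered
  pairs of equal coordinates, the diagonal included. Splitting off the frequency zero leaves
  \<open>(n + 1)\<^sup>2 - n (n + 1) = n + 1\<close> as the constant.\<close>

lemma PHP_fun_power_sums:
  assumes n: "n \<ge> 1" and x: "x \<in> carrier (PHP_group n)"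
  shows "2 * of_nat n * PHP_fun n x =
    of_nat (n + 1) + (\<Sum>k\<in>{1..<n}. complex_of_real ((cmod (\<Sum>i\<in>{1..n+1}. unity_root n (int k * x i)))\<^sup>2))"
proof -
  define S where "S k = (\<Sum>i\<in>{1..n+1}. unity_root n (int k * x i))" for k
  have dvd: "int n dvd x i - x j \<longleftrightarrow> x i = x j" if "i \<in> {1..n+1}" "j \<in> {1..n+1}" for i j
  proof -
    have "x i \<in> {0..<int n}" "x j \<in> {0..<int n}"
      using x that unfolding carrier_PHP_group[OF n] by (auto simp: PiE_iff)
    then show ?thesis
      by (auto simp: mod_eq_dvd_iff[symmetric])
  qed
  have "complex_of_real ((cmod (S k))\<^sup>2) =
      (\<Sum>i\<in>{1..n+1}. \<Sum>j\<in>{1..n+1}. unity_root n (int k * (x i - x j)))" for k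
  proof -
    have "complex_of_real ((cmod (S k))\<^sup>2) = S k * cnj (S k)"
      by (simp only: complex_norm_square)
    also have "\<dots> = (\<Sum>i\<in>{1..n+1}. \<Sum>j\<in>{1..n+1}. unity_root n (int k * x i) * cnj (unity_root n (int k * x j)))"
      unfolding S_def cnj_sum sum_product ..
    finally show ?thesis
      by (simp only: cnj_unity_root unity_root_add[symmetric] right_diff_distrib add_uminus_conv_diff)
  qed
  then have "(\<Sum>k<n. complex_of_real ((cmod (S k))\<^sup>2)) =
      (\<Sum>k<n. \<Sum>i\<in>{1..n+1}. \<Sum>j\<in>{1..n+1}. unity_root n (int k * (x i - x j)))"
    by simp
  also have "\<dots> = (\<Sum>i\<in>{1..n+1}. \<Sum>j\<in>{1..n+1}. \<Sum>k<n. unity_root n (int k * (x i - x j)))"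
    by (subst sum.swap, rule sum.cong[OF refl], subst sum.swap, rule refl)
  also have "\<dots> = (\<Sum>i\<in>{1..n+1}. \<Sum>j\<in>{1..n+1}. of_nat n * Eqv (x i) (x j))"
    by (intro sum.cong refl) (simp only: sum_unity_root[OF n] dvd, simp add: Eqv_def)
  also have "\<dots> = of_nat n * (\<Sum>i\<in>{1..n+1}. \<Sum>j\<in>{1..n+1}. Eqv (x i) (x j))"
    by (simp only: sum_distrib_left)
  also have "(\<Sum>i\<in>{1..n+1}. \<Sum>j\<in>{1..n+1}. Eqv (x i) (x j)) = of_nat (n + 1) + 2 * PHP_fun n x"
    by (subst sum_square_symmetric) (auto simp: Eqv_def PHP_fun_def)
  finally have total: "(\<Sum>k<n. complex_of_real ((cmod (S k))\<^sup>2)) =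
      of_nat n * (of_nat (n + 1) + 2 * PHP_fun n x)" .
  have "{..<n} = insert 0 {1..<n}"
    using n by auto
  then have "(\<Sum>k<n. complex_of_real ((cmod (S k))\<^sup>2)) =
      complex_of_real ((cmod (S 0))\<^sup>2) + (\<Sum>k\<in>{1..<n}. complex_of_real ((cmod (S k))\<^sup>2))"
    by simp
  moreover have "S 0 = of_nat (n + 1)"
    by (simp add: S_def)
  then have "complex_of_real ((cmod (S 0))\<^sup>2) = (of_nat (n + 1))\<^sup>2"
    by (simp only: norm_of_nat of_real_power of_real_of_nat_eq)
  ultimately show ?thesis
    using total unfolding S_def by (simp add: algebra_simps power2_eq_square)
qed

text \<open>Dividing the previous identity by \<open>2 n\<close> gives one square for each frequency, the square at
  frequency zero being the constant. The characters \<open>coordinate_character n 0 i\<close> all coincide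
  with the trivial one, so this square contributes a single element to the support.\<close>

lemma PHP_fun_FSOS:
  assumes n: "n \<ge> 1"
  shows "\<exists>(I::nat set) g. is_FSOS (PHP_group n) (PHP_fun n) I g \<and>
    FSOS_sparsity (PHP_group n) I g \<le> n\<^sup>2"
proof -
  interpret group "PHP_group n"
    by (rule group_PHP_group)
  \<comment> \<open>The constant is written as a sum with one term, so that all squares have the same form.\<close>
  define s where "s k = (if k = 0 then sqrt (real (n + 1) / real (2 * n)) else 1 / sqrt (real (2 * n)))" for k :: nat
  define A where "A k = (if k = 0 then {1} else {1..n+1})" for k :: nat
  define g where "g k x = (\<Sum>i\<in>A k. complex_of_real (s k) * unity_root n (int k * x i))" for k x
  have "PHP_fun n x = (\<Sum>k<n. complex_of_real ((cmod (g k x))\<^sup>2))"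
    if x: "x \<in> carrier (PHP_group n)" for x
  proof -
    define T where "T = (\<Sum>k\<in>{1..<n}. complex_of_real ((cmod (\<Sum>i\<in>{1..n+1}. unity_root n (int k * x i)))\<^sup>2))"
    have g0: "complex_of_real ((cmod (g 0 x))\<^sup>2) = of_nat (n + 1) / of_nat (2 * n)"
      by (simp add: g_def A_def s_def)
    have gk: "complex_of_real ((cmod (g k x))\<^sup>2) =
        complex_of_real ((cmod (\<Sum>i\<in>{1..n+1}. unity_root n (int k * x i)))\<^sup>2) / of_nat (2 * n)"
      if "k \<in> {1..<n}" for k
    proof -
      have "g k x = complex_of_real (1 / sqrt (real (2 * n))) * (\<Sum>i\<in>{1..n+1}. unity_root n (int k * x i))"
        using that unfolding g_def A_def s_def sum_distrib_left by simp
      then have "(cmod (g k x))\<^sup>2 = (cmod (\<Sum>i\<in>{1..n+1}. unity_root n (int k * x i)))\<^sup>2 / real (2 * n)"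
        by (simp only: norm_mult norm_of_real power_mult_distrib power2_abs) (simp add: power_divide)
      then show ?thesis
        by (simp only: of_real_divide of_real_of_nat_eq)
    qed
    have "{..<n} = insert 0 {1..<n}"
      using n by auto
    then have "(\<Sum>k<n. complex_of_real ((cmod (g k x))\<^sup>2)) =
        complex_of_real ((cmod (g 0 x))\<^sup>2) + (\<Sum>k\<in>{1..<n}. complex_of_real ((cmod (g k x))\<^sup>2))"
      by simp
    also have "\<dots> = (of_nat (n + 1) + T) / of_nat (2 * n)"
      unfolding T_def add_divide_distrib sum_divide_distrib g0
      by (intro arg_cong2[of _ _ _ _ "(+)"] sum.cong refl gk)
    also have "\<dots> = PHP_fun n x"
      using n unfolding T_def PHP_fun_power_sums[OF n x, symmetric] by simp
    finally show ?thesis ..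
  qed
  then have "is_FSOS (PHP_group n) (PHP_fun n) {..<n} g"
    by (simp add: is_FSOS_def)
  moreover have "FSOS_sparsity (PHP_group n) {..<n} g \<le> n\<^sup>2"
  proof -
    let ?X = "insert (coordinate_character n 0 1)
      ((\<lambda>(k, i). coordinate_character n k i) ` ({1..<n} \<times> {1..n+1}))"
    have "fourier_supp (PHP_group n) (g k) \<subseteq> coordinate_character n k ` A k" for k
    proof (rule fourier_supp_character_sum[OF finite_carrier_PHP_group[OF n]])
      have "A k \<subseteq> {1..n+1}"
        by (simp add: A_def)
      then show "coordinate_character n k i \<in> characters (PHP_group n)" if "i \<in> A k" for i
        using that by (intro coordinate_character n) blast
      show "g k x = (\<Sum>i\<in>A k. complex_of_real (s k) * coordinate_character n k i x)"
        if "x \<in> carrier (PHP_group n)" for x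
        using that by (simp add: g_def coordinate_character_def)
    qed (simp add: A_def)
    then have "(\<Union>k<n. fourier_supp (PHP_group n) (g k)) \<subseteq> (\<Union>k<n. coordinate_character n k ` A k)"
      by blast
    also have "\<dots> \<subseteq> ?X"
      by (force simp: A_def split: if_splits)
    finally have "FSOS_sparsity (PHP_group n) {..<n} g \<le> card ?X"
      unfolding FSOS_sparsity_def by (intro card_mono) auto
    also have "\<dots> \<le> Suc (card ((\<lambda>(k, i). coordinate_character n k i) ` ({1..<n} \<times> {1..n+1})))"
      by (simp add: card_insert_if)
    also have "\<dots> \<le> Suc (card ({1..<n} \<times> {1..n+1}))"
      by (intro Suc_le_mono[THEN iffD2] card_image_le) simp
    also have "\<dots> = n\<^sup>2"
      using n by (cases n) (auto simp: power2_eq_square)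
    finally show ?thesis .
  qed
  ultimately show ?thesis
    by blast
qed


section \<open>Satisfying assignments and zeros\<close>

lemma PHP_fun_pos_iff: "0 < PHP_fun n x \<longleftrightarrow> \<not> inj_on x {1..n+1}"
proof -
  let ?U = "{(i, j). 1 \<le> i \<and> i < j \<and> j \<le> n + 1}"
  let ?K = "{(i, j) \<in> ?U. x i = x j}"
  have fin: "finite ?U"
    by (auto intro: finite_subset[of _ "{1..n+1} \<times> {1..n+1}"])
  have "PHP_fun n x = (\<Sum>p\<in>?U. if x (fst p) = x (snd p) then 1 else 0)"
    by (simp add: PHP_fun_def Eqv_def case_prod_beta)
  also have "\<dots> = (\<Sum>p\<in>{p \<in> ?U. x (fst p) = x (snd p)}. 1)"
    using fin by (rule sum.inter_filter[symmetric])
  also have "\<dots> = of_real (real (card {p \<in> ?U. x (fst p) = x (snd p)}))"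
    by simp
  also have "{p \<in> ?U. x (fst p) = x (snd p)} = ?K"
    by auto
  finally have "0 < PHP_fun n x \<longleftrightarrow> card ?K > 0"
    by (simp add: less_complex_def)
  also have "\<dots> \<longleftrightarrow> ?K \<noteq> {}"
    using finite_subset[OF _ fin, of ?K] by (auto simp: card_gt_0_iff)
  also have "\<dots> \<longleftrightarrow> \<not> inj_on x {1..n+1}"
  proof
    assume "?K \<noteq> {}"
    then show "\<not> inj_on x {1..n+1}"
      by (force dest: inj_onD)
  next
    assume "\<not> inj_on x {1..n+1}"
    then show "?K \<noteq> {}"
      by (rule contrapos_nn) (rule linorder_inj_onI, auto)
  qed
  finally show ?thesis .
qed

lemma cnf_true_PHP_cnf_iff:
  "cnf_true v (PHP_cnf n) \<longleftrightarrow>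
    (\<forall>i\<in>{1..n+1}. \<exists>j\<in>{1..n}. v (i, j)) \<and>
    (\<forall>i j k. 1 \<le> i \<and> i < k \<and> k \<le> n + 1 \<and> 1 \<le> j \<and> j \<le> n \<longrightarrow> \<not> (v (i, j) \<and> v (k, j)))"
proof -
  have pigeon: "(\<exists>l\<in>{Pos (i, j) | j. j \<in> {1..n}}. lit_true v l) \<longleftrightarrow> (\<exists>j\<in>{1..n}. v (i, j))" for i
    by (auto simp del: atLeastAtMost_iff)
  have collision: "(\<exists>l\<in>{Neg p, Neg q}. lit_true v l) \<longleftrightarrow> \<not> (v p \<and> v q)" for p q
    by simp
  have image1: "(\<forall>C\<in>{F i | i. i \<in> A}. Q C) \<longleftrightarrow> (\<forall>i\<in>A. Q (F i))"
    for F :: "nat \<Rightarrow> (nat \<times> nat) clause" and A Q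
    by blast
  have image3: "(\<forall>C\<in>{F i j k | i j k. R i j k}. Q C) \<longleftrightarrow> (\<forall>i j k. R i j k \<longrightarrow> Q (F i j k))"
    for F :: "nat \<Rightarrow> nat \<Rightarrow> nat \<Rightarrow> (nat \<times> nat) clause" and R Q
    by blast
  show ?thesis
    unfolding cnf_true_def PHP_cnf_def ball_Un image1 image3 pigeon collision ..
qed

text \<open>An assignment may put a pigeon into several holes; choosing one of them for each pigeon
  gives a point of the group, injective since no hole is shared.\<close>

lemma PHP_satisfiable_iff:
  assumes n: "n \<ge> 1"
  shows "(\<exists>v. cnf_true v (PHP_cnf n)) \<longleftrightarrow> (\<exists>x\<in>carrier (PHP_group n). inj_on x {1..n+1})"
proof
  assume "\<exists>v. cnf_true v (PHP_cnf n)"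
  then obtain v where v: "cnf_true v (PHP_cnf n)" ..
  then have "\<forall>i\<in>{1..n+1}. \<exists>j\<in>{1..n}. v (i, j)"
    unfolding cnf_true_PHP_cnf_iff by blast
  then obtain h where h: "\<And>i. i \<in> {1..n+1} \<Longrightarrow> h i \<in> {1..n} \<and> v (i, h i)"
    by metis
  have inj: "inj_on h {1..n+1}"
  proof (rule linorder_inj_onI)
    fix i k assume "i < k" and ik: "i \<in> {1..n+1}" "k \<in> {1..n+1}"
    then have "\<not> (v (i, h i) \<and> v (k, h i))"
      using v h[OF ik(1)] unfolding cnf_true_PHP_cnf_iff atLeastAtMost_iff by blast
    then show "h i \<noteq> h k"
      using h ik by metis
  qed auto
  \<comment> \<open>Holes are numbered from one, residues from zero.\<close>
  define x where "x = (\<lambda>i\<in>{1..n+1}. int (h i) - 1)"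
  have "x \<in> carrier (PHP_group n)"
    using h unfolding carrier_PHP_group[OF n] x_def by fastforce
  moreover have "inj_on x {1..n+1}"
    using inj by (auto simp: x_def inj_on_def)
  ultimately show "\<exists>x\<in>carrier (PHP_group n). inj_on x {1..n+1}"
    by blast
next
  assume "\<exists>x\<in>carrier (PHP_group n). inj_on x {1..n+1}"
  then obtain x where x: "x \<in> {1..n+1} \<rightarrow>\<^sub>E {0..<int n}" and inj: "inj_on x {1..n+1}"
    unfolding carrier_PHP_group[OF n] ..
  let ?v = "\<lambda>(i, j). x i = int j - 1"
  have "\<exists>j\<in>{1..n}. ?v (i, j)" if "i \<in> {1..n+1}" for i
  proof -
    have "x i \<in> {0..<int n}"
      using x that by (rule PiE_mem)
    then show ?thesis
      by (intro bexI[of _ "nat (x i + 1)"]) auto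
  qed
  moreover have "\<not> (?v (i, j) \<and> ?v (k, j))" if "1 \<le> i" "i < k" "k \<le> n + 1" for i k j
    using inj_onD[OF inj, of i k] that by auto
  ultimately have "cnf_true ?v (PHP_cnf n)"
    unfolding cnf_true_PHP_cnf_iff by (intro conjI allI impI) (blast, metis)
  then show "\<exists>v. cnf_true v (PHP_cnf n)"
    by blast
qed

theorem proposition6p2:
  shows "(\<forall>n\<ge>1. cnf_unsat (PHP_cnf n) \<longleftrightarrow> positive_fun (PHP_group n) (PHP_fun n)) \<and>
    (\<exists>C::real. \<forall>n\<ge>1. \<exists>(I::nat set) g.
       is_FSOS (PHP_group n) (PHP_fun n) I g \<and>
       real (FSOS_sparsity (PHP_group n) I g) \<le> C * (real n)\<^sup>2)"
proof (intro conjI allI impI exI[of _ "1::real"])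
  fix n :: nat assume n: "n \<ge> 1"
  show "cnf_unsat (PHP_cnf n) \<longleftrightarrow> positive_fun (PHP_group n) (PHP_fun n)"
    unfolding cnf_unsat_def positive_fun_def PHP_fun_pos_iff PHP_satisfiable_iff[OF n] by blast
next
  fix n :: nat assume "n \<ge> 1"
  from PHP_fun_FSOS[OF this] obtain I :: "nat set" and g where
    "is_FSOS (PHP_group n) (PHP_fun n) I g" and sparse: "FSOS_sparsity (PHP_group n) I g \<le> n\<^sup>2"
    by blast
  moreover have "real (FSOS_sparsity (PHP_group n) I g) \<le> 1 * (real n)\<^sup>2"
    using of_nat_mono[OF sparse, where 'a = real] by simp
  ultimately show "\<exists>(I::nat set) g. is_FSOS (PHP_group n) (PHP_fun n) I g \<and>
      real (FSOS_sparsity (PHP_group n) I g) \<le> 1 * (real n)\<^sup>2"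
    by blast
qed

end
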